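(* Let $n\ge1$ and $1\le k\le n$ be integers. The following two statements are equivalent: (i) there exists $x\in\mathbb F_{2^n}$ such that $\Delta(x,x^2,x^{2^2},\dots,x^{2^{k-1}})\ne0$ and $\Delta_1(x,x^2,x^{2^2},\dots,x^{2^{k-1}})=0$; (ii) $X^n-1$ has a factor in $\mathbb F_2[X]$ of the form $X^k+a_{k-1}X^{k-1}+\cdots+a_2X^2+a_0$ (with $a_i\in\mathbb F_2$).
   Context: For indeterminates $X_1,\dots,X_k$, $\Delta(X_1,\dots,X_k)\in\mathbb F_2[X_1,\dots,X_k]$ is the Moore determinant: the determinant of the $k\times k$ matrix whose $(r,c)$ entry is $X_c^{2^{r-1}}$ ($1\le r,c\le k$). $\Delta_1(X_1,\dots,X_k)\in\mathbb F_2[X_1,\dots,X_k]$ is the determinant of the $k\times k$ matrix whose rows are $(X_1^{2^m},\dots,X_k^{2^m})$ for $m=0,2,3,\dots,k$ (i.e. exponents $2^0,2^2,2^3,\dots,2^k$, omitting $2^1$), in that order. *)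

theory Defs
  imports "Jordan_Normal_Form.Determinant" "HOL-Library.Z2" "HOL-Library.Cardinality"
begin

text \<open>
  Both determinants have coefficients in the prime ring, so they are defined over an
  arbitrary commutative ring: at the indeterminates of a polynomial ring they are the
  polynomials themselves, at elements of a ring their values, and these agree because
  the definitions commute with ring homomorphisms (\<open>hom_moore_det\<close>, \<open>hom_moore_det1\<close>).
  Indices are shifted to start at 0: row \<open>r\<close>, column \<open>c\<close> and the argument \<open>X c\<close> stand for
  \<open>r + 1\<close>, \<open>c + 1\<close> and the argument number \<open>c + 1\<close>.
\<close>

definition moore_det :: "nat \<Rightarrow> (nat \<Rightarrow> 'a::comm_ring_1) \<Rightarrow> 'a" where
  "moore_det k X = det (mat k k (\<lambda>(r, c). X c ^ (2 ^ r)))"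

text \<open>
  The rows are indexed by \<open>m = 0, 2, 3, \<dots>, k\<close>; for \<open>k = 1\<close> the only row is \<open>m = 0\<close>.
\<close>

definition moore_det1 :: "nat \<Rightarrow> (nat \<Rightarrow> 'a::comm_ring_1) \<Rightarrow> 'a" where
  "moore_det1 k X = det (mat k k (\<lambda>(r, c). X c ^ (2 ^ (if r = 0 then 0 else r + 1))))"

lemma (in comm_ring_hom) hom_moore_det:
  "hom (moore_det k X) = moore_det k (\<lambda>c. hom (X c))"
  unfolding moore_det_def hom_det[symmetric]
  by (rule arg_cong[where f = det]) (auto simp: hom_power)

lemma (in comm_ring_hom) hom_moore_det1:
  "hom (moore_det1 k X) = moore_det1 k (\<lambda>c. hom (X c))"
  unfolding moore_det1_def hom_det[symmetric]
  by (rule arg_cong[where f = det]) (auto simp: hom_power)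

end

theory Submission
  imports Defs "HOL-Computational_Algebra.Polynomial_Factorial"
begin

text \<open>
  Let \<open>\<sigma>\<close> be the squaring map, so that \<open>X \<mapsto> \<sigma>\<close> makes the field \<open>F\<close> with \<open>2\<^sup>n\<close> elements a module over
  \<open>F\<^sub>2[X]\<close>, killed by \<open>X\<^sup>n - 1\<close>. At \<open>(x, x\<^sup>2, \<dots>)\<close> both determinants become Hankel-like in
  \<open>Y m = x ^ 2 ^ m\<close>: \<open>\<Delta> \<noteq> 0\<close> says that no nonzero \<open>v\<close> satisfies \<open>\<Sum>m<k. v m * Y (c + m) = 0\<close> for all
  \<open>c < k\<close>, and \<open>\<Delta>\<^sub>1 = 0\<close> says that some nonzero \<open>w\<close> with \<open>w 1 = 0\<close> satisfies
  \<open>\<Sum>m\<le>k. w m * Y (c + m) = 0\<close> for all \<open>c < k\<close>.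

  If both hold, \<open>w\<close> may be taken monic, and the coefficient condition \<open>w 1 = 0\<close> forces every \<open>w m\<close>
  to be fixed by \<open>\<sigma>\<close>. So \<open>w\<close> is a polynomial over \<open>F\<^sub>2\<close> killing \<open>x\<close>, and its remainder in the division
  of \<open>X\<^sup>n - 1\<close> vanishes because \<open>\<Delta> \<noteq> 0\<close>. Conversely, if \<open>X\<^sup>n - 1 = q p\<close>, apply \<open>q(\<sigma>)\<close> to a normal
  element (a generator of the module): the result has annihilator exactly \<open>p\<close>, and its relations
  over \<open>F\<close> of least degree would be relations over \<open>F\<^sub>2\<close>.
\<close>

text \<open>
  Makes \<open>bit poly\<close> a factorial ring, which supplies prime multiplicities for polynomials.
\<close>

instantiation bit ::
  "{unique_euclidean_ring, normalization_euclidean_semiring, normalization_semidom_multiplicative}"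
begin

definition normalize_bit :: "bit \<Rightarrow> bit" where [simp]: "normalize_bit = id"
definition unit_factor_bit :: "bit \<Rightarrow> bit" where [simp]: "unit_factor_bit = id"
definition euclidean_size_bit :: "bit \<Rightarrow> nat" where [simp]: "euclidean_size_bit = of_bit"
definition division_segment_bit :: "bit \<Rightarrow> bit" where [simp]: "division_segment_bit x = 1"

instance
  by standard simp_all

end

instantiation bit :: euclidean_ring_gcd
begin

definition gcd_bit :: "bit \<Rightarrow> bit \<Rightarrow> bit" where
  "gcd_bit = Euclidean_Algorithm.gcd"
definition lcm_bit :: "bit \<Rightarrow> bit \<Rightarrow> bit" where
  "lcm_bit = Euclidean_Algorithm.lcm"
definition Gcd_bit :: "bit set \<Rightarrow> bit" where
  "Gcd_bit = Euclidean_Algorithm.Gcd"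
definition Lcm_bit :: "bit set \<Rightarrow> bit" where
  "Lcm_bit = Euclidean_Algorithm.Lcm"

instance
  by standard (simp_all add: gcd_bit_def lcm_bit_def Gcd_bit_def Lcm_bit_def)

end

instance bit :: field_gcd ..

section \<open>Polynomials over \<open>bit\<close> acting through the squaring map\<close>

lemma freshman2: "CHAR('a::comm_ring_1) = 2 \<Longrightarrow> (x + y)\<^sup>2 = x\<^sup>2 + (y::'a)\<^sup>2"
  by (rule freshmans_dream) auto

lemma freshman2_sum:
  "CHAR('a::comm_ring_1) = 2 \<Longrightarrow> (\<Sum>i\<in>A. f i)\<^sup>2 = (\<Sum>i\<in>A. (f i :: 'a)\<^sup>2)"
  by (rule freshmans_dream_sum) auto

definition bit_emb :: "bit \<Rightarrow> 'a::comm_ring_1" where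
  "bit_emb b = of_bit b"

lemma bit_emb_simps [simp]: "bit_emb 0 = 0" "bit_emb 1 = 1"
  by (simp_all add: bit_emb_def)

lemma bit_emb_power [simp]: "0 < m \<Longrightarrow> bit_emb b ^ m = bit_emb b"
  by (cases b) (auto simp: power_0_left)

lemma bit_emb_eq_0_iff [simp]: "bit_emb b = 0 \<longleftrightarrow> b = 0"
  by (cases b) auto

lemma bit_emb_add: "CHAR('a::comm_ring_1) = 2 \<Longrightarrow> bit_emb (a + b) = bit_emb a + (bit_emb b :: 'a)"
  using of_nat_CHAR[where 'a='a] by (cases a; cases b) auto

text \<open>This is \<open>p(\<sigma>) x\<close>, the value at \<open>x\<close> of the linearized
  polynomial associated with \<open>p\<close>.\<close>

definition lin_eval :: "bit poly \<Rightarrow> 'a::comm_ring_1 \<Rightarrow> 'a" where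
  "lin_eval p x = (\<Sum>i\<le>degree p. bit_emb (coeff p i) * x ^ (2 ^ i))"

lemma lin_eval_extend:
  assumes "degree p \<le> N"
  shows "lin_eval p x = (\<Sum>i\<le>N. bit_emb (coeff p i) * x ^ (2 ^ i))"
  unfolding lin_eval_def
  by (rule sum.mono_neutral_left) (use assms in \<open>auto simp: coeff_eq_0\<close>)

lemma lin_eval_lessThan:
  assumes "degree p < N"
  shows "lin_eval p x = (\<Sum>i<N. bit_emb (coeff p i) * x ^ (2 ^ i))"
  unfolding lin_eval_def
  by (rule sum.mono_neutral_left) (use assms in \<open>auto simp: coeff_eq_0\<close>)

lemma lin_eval_0 [simp]: "lin_eval 0 x = 0"
  by (simp add: lin_eval_def)

lemma lin_eval_zero_right [simp]: "lin_eval p 0 = 0"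
  by (simp add: lin_eval_def power_0_left)

text \<open>Horner form: coefficients from \<open>F_2\<close> are fixed by squaring, so one \<sigma>
  can be pulled out of all higher terms.\<close>

lemma lin_eval_pCons:
  assumes "CHAR('a::comm_ring_1) = 2"
  shows "lin_eval (pCons a p) (x::'a) = bit_emb a * x + lin_eval p x ^ 2"
proof -
  have "lin_eval (pCons a p) x = (\<Sum>i\<le>Suc (degree p). bit_emb (coeff (pCons a p) i) * x ^ (2 ^ i))"
    by (rule lin_eval_extend) (rule degree_pCons_le)
  also have "\<dots> = bit_emb a * x + (\<Sum>i\<le>degree p. (bit_emb (coeff p i) * x ^ (2 ^ i)) ^ 2)"
    by (subst sum.atMost_Suc_shift) (simp add: power_mult_distrib mult.commute flip: power_mult)
  finally show ?thesis
    unfolding lin_eval_def[of p] using freshman2_sum[OF assms] by metis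
qed

lemma lin_eval_add:
  assumes "CHAR('a::comm_ring_1) = 2"
  shows "lin_eval (p + q) (x::'a) = lin_eval p x + lin_eval q x"
proof -
  have "lin_eval r x = (\<Sum>i\<le>max (degree p) (degree q). bit_emb (coeff r i) * x ^ (2 ^ i))"
    if "r \<in> {p, q, p + q}" for r
    by (rule lin_eval_extend) (use that degree_add_le_max[of p q] in auto)
  from this[of p] this[of q] this[of "p + q"] show ?thesis
    by (simp only: insert_iff simp_thms coeff_add bit_emb_add[OF assms] sum.distrib distrib_right)
qed

lemma lin_eval_smult: "lin_eval (smult a p) x = bit_emb a * lin_eval p x"
  by (cases a) auto

lemma lin_eval_mult:
  assumes "CHAR('a::comm_ring_1) = 2"
  shows "lin_eval (p * q) (x::'a) = lin_eval p (lin_eval q x)"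
  by (induction p) (simp_all add: lin_eval_pCons lin_eval_add lin_eval_smult assms)

lemma lin_eval_mult':
  assumes "CHAR('a::comm_ring_1) = 2"
  shows "lin_eval (p * q) (x::'a) = lin_eval q (lin_eval p x)"
  using lin_eval_mult[OF assms, of q p] by (simp add: mult.commute)

lemma lin_eval_add_right:
  assumes "CHAR('a::comm_ring_1) = 2"
  shows "lin_eval p (x + y::'a) = lin_eval p x + lin_eval p y"
  by (induction p) (simp_all add: lin_eval_pCons freshman2 assms algebra_simps)

lemma lin_eval_1 [simp]: "lin_eval 1 x = x"
  by (simp add: lin_eval_def)

lemma lin_eval_monom: "lin_eval (monom 1 n) x = x ^ (2 ^ n)"
proof -
  have "lin_eval (monom 1 n) x = (\<Sum>i\<le>n. if n = i then x ^ (2 ^ i) else 0)"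
    unfolding lin_eval_def degree_monom_eq[OF one_neq_zero] by (rule sum.cong) auto
  then show ?thesis
    by simp
qed

lemma lin_eval_frobenius:
  assumes "CHAR('a::comm_ring_1) = 2"
  shows "lin_eval p ((x::'a) ^ (2 ^ c)) = lin_eval p x ^ (2 ^ c)"
  using lin_eval_mult[OF assms, of p "monom 1 c" x] lin_eval_mult'[OF assms, of p "monom 1 c" x]
  by (simp add: lin_eval_monom)

lemma lin_eval_diff:
  assumes "CHAR('a::comm_ring_1) = 2"
  shows "lin_eval (p - q) (x::'a) = lin_eval p x - lin_eval q x"
  using lin_eval_add[OF assms, of "p - q" q x] by simp

text \<open>Turns a relation over the field whose coefficients happen to be 0 or 1 into a polynomial
  over \<open>bit\<close>, where division is available.\<close>

lemma lin_eval_sum_powers: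
  fixes x :: "'a::comm_ring_1"
  assumes "\<And>m. m < d \<Longrightarrow> v m = 0 \<or> v m = 1"
  obtains r where "\<And>m. coeff r m = (if m < d \<and> v m = 1 then 1 else 0)"
    and "lin_eval r x = (\<Sum>m<d. v m * x ^ (2 ^ m))"
proof
  define r :: "bit poly" where "r = Poly (map (\<lambda>m. if v m = 1 then 1 else 0) [0..<d])"
  show c: "coeff r m = (if m < d \<and> v m = 1 then 1 else 0)" for m
    by (auto simp: r_def coeff_Poly_eq nth_default_def)
  show "lin_eval r x = (\<Sum>m<d. v m * x ^ (2 ^ m))"
  proof (cases "r = 0")
    case True
    then have "v m = 0" if "m < d" for m
      using c[of m] assms[of m] that by (auto split: if_splits)
    with True show ?thesis
      by simp
  next
    case False
    then have "coeff r (degree r) \<noteq> 0"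
      by simp
    then have "degree r < d"
      using c[of "degree r"] by (auto split: if_splits)
    then show ?thesis
      unfolding lin_eval_lessThan[OF \<open>degree r < d\<close>]
    proof (intro sum.cong refl)
      fix m assume "m \<in> {..<d}"
      then show "bit_emb (coeff r m) * x ^ (2 ^ m) = v m * x ^ (2 ^ m)"
        using assms[of m] by (auto simp: c)
    qed
  qed
qed

section \<open>Fields with \<open>2 ^ n\<close> elements\<close>

lemma CHAR_of_card_two_power:
  assumes "CARD('a::{field,finite}) = 2 ^ n"
  shows "CHAR('a) = 2"
proof -
  have "prime CHAR('a)"
    using finite_imp_CHAR_pos[where 'a='a] by (intro prime_CHAR_semidom) auto
  moreover have "(\<Sum>x\<in>UNIV. x + 1) = (\<Sum>x\<in>UNIV. x :: 'a)"
    by (rule sum.reindex_bij_witness[of _ "\<lambda>x. x - 1" "\<lambda>x. x + 1"]) auto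
  then have "of_nat CARD('a) = (0 :: 'a)"
    by (simp add: sum.distrib)
  then have "CHAR('a) dvd 2 ^ n"
    by (simp only: of_nat_eq_0_iff_char_dvd assms)
  ultimately show ?thesis
    by (metis prime_dvd_power primes_dvd_imp_eq two_is_prime_nat)
qed

lemma power_CARD: "(x::'a::{field,finite}) ^ CARD('a) = x"
proof (cases "x = 0")
  case False
  let ?U = "UNIV - {0::'a}"
  have "bij_betw ((*) x) ?U ?U"
    by (rule bij_betw_byWitness[where f' = "\<lambda>y. y / x"]) (use False in auto)
  then have "prod (\<lambda>y. x * y) ?U = \<Prod>?U"
    by (rule prod.reindex_bij_betw)
  then have "x ^ card ?U = 1"
    by (simp add: prod.distrib)
  then show ?thesis
    using power_Suc[of x "card ?U"] by (simp add: card.remove[of UNIV 0] del: card_Diff_insert)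
qed (simp add: power_0_left)

text \<open>The associated ordinary polynomial \<open>R\<close> has degree at most
  \<open>2 ^ (n - 1)\<close>, too small to vanish on the whole field unless it is zero.\<close>

lemma lin_eval_eq_0_on_field:
  assumes "CARD('a::{field,finite}) = 2 ^ n" and "degree r < n" and "\<And>x::'a. lin_eval r x = 0"
  shows "r = 0"
proof (rule ccontr)
  assume "r \<noteq> 0"
  then have "lead_coeff r = 1"
    using bit_not_zero_iff leading_coeff_0_iff by blast
  define R :: "'a poly" where "R = (\<Sum>i<n. monom (bit_emb (coeff r i)) (2 ^ i))"
  have "coeff R (2 ^ degree r) = (\<Sum>i<n. if degree r = i then bit_emb (coeff r i) else 0)"
    unfolding R_def coeff_sum coeff_monom by (rule sum.cong) auto
  also have "\<dots> = 1"
    using assms(2) \<open>lead_coeff r = 1\<close> by simp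
  finally have "R \<noteq> 0"
    by auto
  have "degree R \<le> 2 ^ (n - 1)"
    unfolding R_def
    by (intro degree_sum_le) (auto intro!: order.trans[OF degree_monom_le] power_increasing)
  moreover have "poly R x = 0" for x
    using assms(3)[of x] unfolding lin_eval_lessThan[OF assms(2)]
    by (simp add: R_def poly_sum poly_monom)
  then have "CARD('a) \<le> degree R"
    using card_poly_roots_bound[OF \<open>R \<noteq> 0\<close>] by simp
  moreover have "(2::nat) ^ (n - 1) < 2 ^ n"
    using assms(2) by (intro power_strict_increasing) auto
  ultimately show False
    using assms(1) by linarith
qed

section \<open>Annihilators of field elements\<close>

definition annihilator :: "'a::comm_ring_1 \<Rightarrow> bit poly \<Rightarrow> bool" where
  "annihilator x m \<longleftrightarrow> m \<noteq> 0 \<and> (\<forall>h. lin_eval h x = 0 \<longleftrightarrow> m dvd h)"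

text \<open>A killing polynomial of least degree divides every other one, since the remainder also
  kills \<open>x\<close>.\<close>

lemma annihilator_exists:
  assumes "CHAR('a::field) = 2" and "p \<noteq> 0" and "lin_eval p (x::'a) = 0"
  obtains m where "annihilator x m"
proof -
  obtain m where m: "m \<noteq> 0" "lin_eval m x = 0"
    and min: "\<And>h. h \<noteq> 0 \<Longrightarrow> lin_eval h x = 0 \<Longrightarrow> degree m \<le> degree h"
    using ex_has_least_nat[of "\<lambda>h. h \<noteq> 0 \<and> lin_eval h x = 0" p degree] assms by blast
  have "m dvd h" if "lin_eval h x = 0" for h
  proof -
    have "lin_eval (h mod m) x = lin_eval h x - lin_eval (h div m * m) x"
      by (simp add: minus_div_mult_eq_mod flip: lin_eval_diff[OF assms(1)])
    then have "lin_eval (h mod m) x = 0"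
      using that m by (simp add: lin_eval_mult assms(1))
    then have "h mod m = 0"
      using min[of "h mod m"] degree_mod_less[OF m(1), of h] by force
    then show ?thesis
      by auto
  qed
  moreover have "lin_eval h x = 0" if "m dvd h" for h
    using that m(2) by (auto simp: lin_eval_mult' assms(1) elim!: dvdE)
  ultimately show ?thesis
    using m(1) by (intro that) (auto simp: annihilator_def)
qed

text \<open>\<open>h\<close> kills \<open>p(\<sigma>) x\<close> exactly when \<open>p * h\<close>
  kills \<open>x\<close>, and \<open>p\<close> cancels from \<open>p * q dvd p * h\<close>.\<close>

lemma annihilator_lin_eval:
  assumes "CHAR('a::field) = 2" and "annihilator (x::'a) (p * q)"
  shows "annihilator (lin_eval p x) q"
  using assms(2) by (auto simp: annihilator_def simp flip: lin_eval_mult'[OF assms(1)])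

text \<open>If \<open>h\<close> kills \<open>x + y\<close>, multiplying by \<open>q\<close> removes
  \<open>y\<close>, so \<open>h * q\<close> kills \<open>x\<close>; coprimality strips
  \<open>q\<close> again. The other factor is symmetric.\<close>

lemma annihilator_add:
  assumes "CHAR('a::field) = 2" and x: "annihilator (x::'a) p" and y: "annihilator y q"
    and "coprime p q"
  shows "annihilator (x + y) (p * q)"
proof -
  have "p dvd h \<and> q dvd h" if h: "lin_eval h (x + y) = 0" for h
  proof -
    have "lin_eval (h * q) x + lin_eval (h * q) y = 0" "lin_eval (h * p) x + lin_eval (h * p) y = 0"
      using h by (simp_all add: lin_eval_mult' assms(1) flip: lin_eval_add_right)
    moreover have "lin_eval (h * q) y = 0" "lin_eval (h * p) x = 0"
      using x y by (auto simp: annihilator_def)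
    ultimately have "p dvd h * q" "q dvd h * p"
      using x y by (auto simp: annihilator_def)
    with \<open>coprime p q\<close> show ?thesis
      by (simp add: coprime_dvd_mult_left_iff coprime_commute)
  qed
  moreover have "lin_eval h (x + y) = 0" if "p * q dvd h" for h
  proof -
    have "lin_eval h x = 0" "lin_eval h y = 0"
      using that x y dvd_mult_left[of p q h] dvd_mult_right[of p q h] by (simp_all add: annihilator_def)
    then show ?thesis
      by (simp add: lin_eval_add_right assms(1))
  qed
  ultimately show ?thesis
    using x y \<open>coprime p q\<close> by (auto simp: annihilator_def intro: divides_mult)
qed

lemma degree_pos_of_prime_elem:
  assumes "prime_elem (f :: 'a::field poly)"
  shows "0 < degree f"
proof (rule ccontr)
  assume "\<not> 0 < degree f"
  then have "is_unit f"
    using is_unit_iff_degree[of f] prime_elem_not_zeroI[OF assms] by blast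
  then show False
    using prime_elem_not_unit[OF assms] by blast
qed

text \<open>
  If a prime \<open>f\<close> occurs more often in \<open>g\<close> than in \<open>m\<close>, then trading the \<open>f\<close>-part of \<open>m\<close> for that of \<open>g\<close>
  gives an annihilator of larger degree.
\<close>

lemma annihilator_of_maximal_degree:
  assumes char: "CHAR('a::field) = 2" and x: "annihilator (x::'a) m"
    and max: "\<And>y g. annihilator (y::'a) g \<Longrightarrow> degree g \<le> degree m"
    and y: "annihilator (y::'a) g"
  shows "g dvd m"
proof (rule ccontr)
  have nz: "m \<noteq> 0" "g \<noteq> 0"
    using x y by (auto simp: annihilator_def)
  assume "\<not> g dvd m"
  then obtain f where f: "prime f" "multiplicity f m < multiplicity f g"
    using multiplicity_le_imp_dvd[OF nz(2), of m] not_le by blast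
  have nu: "\<not> is_unit f" and "f \<noteq> 0"
    using f(1) by auto
  obtain a b m' g' where m': "m = f ^ a * m'" "\<not> f dvd m'" and g': "g = f ^ b * g'" and "a < b"
    using multiplicity_decompose'[OF nz(1) nu] multiplicity_decompose'[OF nz(2) nu] f(2) by metis
  have xy: "annihilator x (f ^ a * m')" "annihilator y (g' * f ^ b)"
    using x y by (simp_all only: m'(1)[symmetric] g'[symmetric] mult.commute[of g'])
  have "annihilator (lin_eval (f ^ a) x) m'" "annihilator (lin_eval g' y) (f ^ b)"
    using annihilator_lin_eval[OF char xy(1)] annihilator_lin_eval[OF char xy(2)] .
  moreover have "coprime m' (f ^ b)"
    using f(1) m'(2) by (simp add: prime_imp_coprime coprime_commute)
  ultimately have "degree (m' * f ^ b) \<le> degree m"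
    by (intro max[OF annihilator_add[OF char]])
  moreover have "m' \<noteq> 0"
    using m'(2) by auto
  ultimately have "b * degree f \<le> a * degree f"
    using arg_cong[OF m'(1), of degree] \<open>f \<noteq> 0\<close> by (simp add: degree_mult_eq degree_power_eq)
  moreover have "0 < degree f"
    using f(1) by (intro degree_pos_of_prime_elem) auto
  ultimately show False
    using \<open>a < b\<close> by simp
qed

section \<open>Existence of a normal element\<close>

lemma monom_minus_one_degree:
  assumes "1 \<le> n"
  shows "degree (monom 1 n - 1 :: 'a::comm_ring_1 poly) = n"
  using assms degree_add_eq_left[of "- 1 :: 'a poly" "monom 1 n"] by (simp add: degree_monom_eq)

text \<open>An annihilator of maximal degree is a multiple of all others, so it kills the whole
  field. Its remainder modulo \<open>X^n - 1\<close> does too, and has degree below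
  \<open>n\<close>, hence is zero.\<close>

lemma normal_element_exists:
  assumes "1 \<le> n" and card: "CARD('a::{field,finite}) = 2 ^ n"
  obtains x :: "'a::{field,finite}" where "annihilator x (monom 1 n - 1)"
proof -
  note char = CHAR_of_card_two_power[OF card]
  let ?P = "monom 1 n - 1 :: bit poly"
  have deg: "degree ?P = n"
    using assms(1) by (rule monom_minus_one_degree)
  then have P0: "?P \<noteq> 0"
    using assms(1) by auto
  have kill: "lin_eval ?P x = 0" for x :: 'a
    using power_CARD[of x] by (simp add: lin_eval_diff lin_eval_monom char card)
  have ann_ex: "\<exists>m. annihilator x m" for x :: 'a
    using annihilator_exists[OF char P0 kill] by blast
  have "degree m < Suc n" if "annihilator x m" for x :: 'a and m
    using that kill[of x] P0 deg by (metis annihilator_def dvd_imp_degree_le less_Suc_eq_le)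
  moreover obtain m0 where "annihilator (0::'a) m0"
    using ann_ex by blast
  ultimately have "\<exists>d. (\<exists>x::'a. \<exists>m. annihilator x m \<and> degree m = d) \<and>
      (\<forall>d'. (\<exists>x::'a. \<exists>m. annihilator x m \<and> degree m = d') \<longrightarrow> d' \<le> d)"
    by (intro ex_has_greatest_nat[of _ "degree m0" "\<lambda>d. d" "Suc n"]) blast+
  then obtain x :: 'a and m where x: "annihilator x m"
    and max: "\<And>y g. annihilator (y::'a) g \<Longrightarrow> degree g \<le> degree m"
    by blast
  have m_kill: "lin_eval m y = 0" for y :: 'a
  proof -
    obtain g where "annihilator y g"
      using ann_ex[of y] by blast
    moreover from this have "g dvd m"
      by (intro annihilator_of_maximal_degree[OF char x] max)
    ultimately show ?thesis
      by (simp add: annihilator_def)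
  qed
  have "lin_eval (m mod ?P) y = 0" for y :: 'a
    using m_kill[of y] kill lin_eval_diff[OF char, of m "m div ?P * ?P" y]
    by (simp add: minus_div_mult_eq_mod lin_eval_mult char)
  then have "m mod ?P = 0"
    using lin_eval_eq_0_on_field[OF card, of "m mod ?P"] degree_mod_less[OF P0, of m] deg by auto
  then have "?P dvd m"
    by auto
  moreover have "m dvd ?P"
    using x kill by (auto simp: annihilator_def)
  ultimately have "annihilator x ?P"
    using x P0 by (auto simp: annihilator_def intro: dvd_trans)
  then show ?thesis
    by (rule that)
qed

section \<open>Vanishing determinants as linear relations\<close>

lemma ex_carrier_vec_iff:
  "(\<exists>v\<in>carrier_vec k. v \<noteq> 0\<^sub>v k \<and> P (\<lambda>m. if m < k then v $ m else 0)) \<longleftrightarrow>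
   (\<exists>v. (\<forall>m\<ge>k. v m = 0) \<and> (\<exists>m<k. v m \<noteq> 0) \<and> P v)" for P :: "(nat \<Rightarrow> 'a::zero) \<Rightarrow> bool"
proof (intro iffI; elim bexE exE conjE)
  fix v :: "'a vec" assume "v \<in> carrier_vec k" "v \<noteq> 0\<^sub>v k" "P (\<lambda>m. if m < k then v $ m else 0)"
  then show "\<exists>v. (\<forall>m\<ge>k. v m = 0) \<and> (\<exists>m<k. v m \<noteq> 0) \<and> P v"
    by (intro exI[of _ "\<lambda>m. if m < k then v $ m else 0"]) (auto simp: vec_eq_iff)
next
  fix v m assume v: "\<forall>m\<ge>k. v m = 0" "P v" "m < k" "v m \<noteq> (0::'a)"
  have "(\<lambda>m. if m < k then vec k v $ m else 0) = v"
    using v(1) by auto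
  with v show "\<exists>v\<in>carrier_vec k. v \<noteq> 0\<^sub>v k \<and> P (\<lambda>m. if m < k then v $ m else 0)"
    by (intro bexI[of _ "vec k v"]) (auto simp: vec_eq_iff)
qed

text \<open>The coefficients \<open>v\<close> combine rows, hence the transpose before the kernel
  criterion.\<close>

lemma det_mat_eq_0_iff:
  fixes f :: "nat \<Rightarrow> nat \<Rightarrow> 'a::field"
  shows "det (mat k k (\<lambda>(r, c). f r c)) = 0 \<longleftrightarrow>
    (\<exists>v. (\<forall>m\<ge>k. v m = 0) \<and> (\<exists>m<k. v m \<noteq> 0) \<and> (\<forall>c<k. (\<Sum>m<k. v m * f m c) = 0))"
proof -
  let ?A = "mat k k (\<lambda>(r, c). f c r)"
  have "det (mat k k (\<lambda>(r, c). f r c)) = det ?A"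
    by (subst det_transpose[symmetric, of _ k]) (auto intro!: arg_cong[of _ _ det])
  also have "\<dots> = 0 \<longleftrightarrow> (\<exists>v\<in>carrier_vec k. v \<noteq> 0\<^sub>v k \<and> ?A *\<^sub>v v = 0\<^sub>v k)"
    by (subst det_0_iff_vec_prod_zero_field[of _ k]) auto
  also have "\<dots> \<longleftrightarrow> (\<exists>v\<in>carrier_vec k. v \<noteq> 0\<^sub>v k \<and>
      (\<forall>c<k. (\<Sum>m<k. (if m < k then v $ m else 0) * f m c) = 0))"
    by (intro bex_cong refl conj_cong)
       (auto simp: vec_eq_iff scalar_prod_def mult.commute lessThan_atLeast0)
  also note ex_carrier_vec_iff[where P = "\<lambda>v. \<forall>c<k. (\<Sum>m<k. v m * f m c) = 0"]
  finally show ?thesis .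
qed

lemma power_two_power_power: "(x ^ (2 ^ c)) ^ (2 ^ m) = (x::'a::monoid_mult) ^ (2 ^ (c + m))"
  by (simp only: power_add power_mult)

lemma moore_det_powers_eq_0_iff:
  fixes x :: "'a::field"
  shows "moore_det k (\<lambda>i. x ^ (2 ^ i)) = 0 \<longleftrightarrow>
    (\<exists>v. (\<forall>m\<ge>k. v m = 0) \<and> (\<exists>m<k. v m \<noteq> 0) \<and> (\<forall>c<k. (\<Sum>m<k. v m * x ^ (2 ^ (c + m))) = 0))"
  unfolding moore_det_def power_two_power_power
  using det_mat_eq_0_iff[of k "\<lambda>r c. x ^ (2 ^ (c + r))"] .

lemma moore_det1_powers_eq_0_iff:
  fixes x :: "'a::field"
  assumes "1 \<le> k"
  shows "moore_det1 k (\<lambda>i. x ^ (2 ^ i)) = 0 \<longleftrightarrow>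
    (\<exists>w. w 1 = 0 \<and> (\<exists>m\<le>k. w m \<noteq> 0) \<and> (\<forall>c<k. (\<Sum>m\<le>k. w m * x ^ (2 ^ (c + m))) = 0))"
proof -
  \<comment> \<open>\<open>e\<close> lists the row exponents 0, 2, ..., \<open>k\<close> and
    \<open>e'\<close> undoes it, with \<open>e' 0 = 0\<close> by truncated subtraction. A zero
    coefficient at the omitted index 1 fills the sum up to \<open>{..k}\<close>.\<close>
  define e :: "nat \<Rightarrow> nat" where "e r = (if r = 0 then 0 else r + 1)" for r
  define e' :: "nat \<Rightarrow> nat" where "e' m = m - 1" for m
  have e: "bij_betw e {..<k} ({..k} - {1})"
    by (rule bij_betw_byWitness[where f' = e']) (use assms in \<open>auto simp: e_def e'_def\<close>)
  have e'e: "e' (e r) = r" for r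
    by (auto simp: e_def e'_def)
  have sum: "(\<Sum>r<k. w (e r) * x ^ (2 ^ (c + e r))) = (\<Sum>m\<le>k. w m * x ^ (2 ^ (c + m)))"
    if "w 1 = 0" for w c
    using sum.reindex_bij_betw[OF e, of "\<lambda>m. w m * x ^ (2 ^ (c + m))"] that assms
    by (simp add: sum.remove[of "{..k}" 1])
  have "moore_det1 k (\<lambda>i. x ^ (2 ^ i)) = 0 \<longleftrightarrow>
    (\<exists>v. (\<forall>m\<ge>k. v m = 0) \<and> (\<exists>m<k. v m \<noteq> 0) \<and> (\<forall>c<k. (\<Sum>m<k. v m * x ^ (2 ^ (c + e m))) = 0))"
    unfolding moore_det1_def power_two_power_power e_def[symmetric]
    using det_mat_eq_0_iff[of k "\<lambda>r c. x ^ (2 ^ (c + e r))"] .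
  also have "\<dots> \<longleftrightarrow> (\<exists>w. w 1 = 0 \<and> (\<exists>m\<le>k. w m \<noteq> 0) \<and> (\<forall>c<k. (\<Sum>m\<le>k. w m * x ^ (2 ^ (c + m))) = 0))"
  proof (intro iffI; elim exE conjE)
    fix v m assume v: "\<forall>c<k. (\<Sum>m<k. v m * x ^ (2 ^ (c + e m))) = 0" "m < k" "v m \<noteq> 0"
    define w where "w m = (if m = 1 then 0 else v (e' m))" for m
    have w: "w (e r) = v r" for r
      by (auto simp: w_def e'e) (auto simp: e_def split: if_splits)
    have "w 1 = 0"
      by (simp add: w_def)
    moreover have "w (e m) \<noteq> 0" "e m \<le> k"
      using v w by (auto simp: e_def)
    moreover have "(\<Sum>m\<le>k. w m * x ^ (2 ^ (c + m))) = 0" if "c < k" for c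
      using sum[of w c] \<open>w 1 = 0\<close> v(1) that by (simp add: w)
    ultimately show "\<exists>w. w 1 = 0 \<and> (\<exists>m\<le>k. w m \<noteq> 0) \<and> (\<forall>c<k. (\<Sum>m\<le>k. w m * x ^ (2 ^ (c + m))) = 0)"
      by blast
  next
    fix w m assume w: "w 1 = 0" "\<forall>c<k. (\<Sum>m\<le>k. w m * x ^ (2 ^ (c + m))) = 0" "m \<le> k" "w m \<noteq> 0"
    define v where "v r = (if r < k then w (e r) else 0)" for r
    have "m \<noteq> 1"
      using w by metis
    then have "e (e' m) = m" "e' m < k"
      using w assms by (auto simp: e_def e'_def)
    moreover have "(\<Sum>m<k. v m * x ^ (2 ^ (c + e m))) = 0" if "c < k" for c
      using sum[of w c] w(1,2) that by (simp add: v_def)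
    ultimately show "\<exists>v. (\<forall>m\<ge>k. v m = 0) \<and> (\<exists>m<k. v m \<noteq> 0) \<and> (\<forall>c<k. (\<Sum>m<k. v m * x ^ (2 ^ (c + e m))) = 0)"
      using w(4) by (intro exI[of _ v] conjI exI[of _ "e' m"]) (auto simp: v_def)
  qed
  finally show ?thesis .
qed

section \<open>Nonvanishing of the Moore determinant from an annihilator\<close>

lemma moore_det_nonzero_of_annihilator:
  fixes y :: "'a::{field,finite}"
  assumes "1 \<le> n" and card: "CARD('a) = 2 ^ n" and ann: "annihilator y p" and "degree p = k"
  shows "moore_det k (\<lambda>i. y ^ (2 ^ i)) \<noteq> 0"
proof
  note char = CHAR_of_card_two_power[OF card]
  \<comment> \<open>A relation of least degree, made monic, is compared with its image under squaring.\<close>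
  define B where "B d v \<longleftrightarrow> (\<exists>m<d. v m \<noteq> 0) \<and> (\<forall>c. (\<Sum>m<d. v m * y ^ (2 ^ (c + m))) = 0)"
    for d and v :: "nat \<Rightarrow> 'a"
  assume "moore_det k (\<lambda>i. y ^ (2 ^ i)) = 0"
  then obtain v where v: "\<exists>m<k. v m \<noteq> 0" "\<And>c. c < k \<Longrightarrow> (\<Sum>m<k. v m * y ^ (2 ^ (c + m))) = 0"
    unfolding moore_det_powers_eq_0_iff by blast
  \<comment> \<open>The relation is known only for \<open>c < k\<close>. Modulo \<open>p\<close>,
    every \<open>lin_eval q y\<close> is an \<open>F_2\<close>-combination of the first
    \<open>k\<close> conjugates of \<open>y\<close>, so the additive map \<open>T\<close> kills it;
    this extends the relation to all \<open>c\<close>, as \<open>B\<close> demands.\<close>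
  define T where "T z = (\<Sum>m<k. v m * z ^ (2 ^ m))" for z
  have T_Y: "T (y ^ (2 ^ c)) = (\<Sum>m<k. v m * y ^ (2 ^ (c + m)))" for c
    by (simp only: T_def power_two_power_power)
  have T0: "T (lin_eval q y) = 0" for q
  proof -
    have p: "p \<noteq> 0" "lin_eval p y = 0"
      using ann by (auto simp: annihilator_def)
    have "lin_eval q y = lin_eval (q mod p + q div p * p) y"
      by simp
    also have "\<dots> = lin_eval (q mod p) y"
      using p by (subst lin_eval_add[OF char]) (simp add: lin_eval_mult char)
    finally have q: "lin_eval q y = lin_eval (q mod p) y" .
    show ?thesis
    proof (cases "q mod p = 0")
      case True
      then show ?thesis
        unfolding q by (simp add: T_def power_0_left)
    next
      case False
      then have lt: "degree (q mod p) < k"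
        using degree_mod_less[OF p(1), of q] \<open>degree p = k\<close> by auto
      have "T (lin_eval q y) = (\<Sum>m<k. v m * (\<Sum>c<k. bit_emb (coeff (q mod p) c) * (y ^ (2 ^ m)) ^ (2 ^ c)))"
        unfolding q T_def lin_eval_frobenius[OF char, symmetric] unfolding lin_eval_lessThan[OF lt] ..
      also have "\<dots> = (\<Sum>m<k. \<Sum>c<k. bit_emb (coeff (q mod p) c) * (v m * y ^ (2 ^ (c + m))))"
        by (simp only: power_two_power_power add.commute sum_distrib_left mult.left_commute)
      also have "\<dots> = (\<Sum>c<k. bit_emb (coeff (q mod p) c) * (\<Sum>m<k. v m * y ^ (2 ^ (c + m))))"
        by (subst sum.swap) (simp add: sum_distrib_left)
      also have "\<dots> = 0"
        using v(2) by simp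
      finally show ?thesis .
    qed
  qed
  have "B k v"
    unfolding B_def using v(1) T0[of "monom 1 c" for c] by (simp add: lin_eval_monom T_Y)
  then have ex: "\<exists>d. \<exists>v. B d v"
    by blast
  define d where "d = (LEAST d. \<exists>v. B d v)"
  have min: "d \<le> d'" if "B d' v'" for d' v'
    unfolding d_def using that by (blast intro: Least_le)
  obtain u0 where u0: "B d u0"
    using LeastI_ex[OF ex] unfolding d_def by blast
  obtain d' where d': "d = Suc d'"
    using u0 by (cases d) (auto simp: B_def)
  have "u0 d' \<noteq> 0"
  proof
    assume "u0 d' = 0"
    then have "B d' u0"
      using u0 unfolding B_def d' by (auto simp: less_Suc_eq)
    then show False
      using min[of d'] d' by auto
  qed
  define u where "u m = u0 m / u0 d'" for m
  have "(\<Sum>m<d. u m * y ^ (2 ^ (c + m))) = (\<Sum>m<d. u0 m * y ^ (2 ^ (c + m))) / u0 d'" for c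
    by (simp add: u_def sum_divide_distrib)
  then have u: "u d' = 1" "(\<Sum>m<d. u m * y ^ (2 ^ (c + m))) = 0" for c
    using u0 \<open>u0 d' \<noteq> 0\<close> by (auto simp: B_def u_def)
  have sq: "(\<Sum>m<d. (u m)\<^sup>2 * y ^ (2 ^ (Suc c + m))) = 0" for c
  proof -
    have "(\<Sum>m<d. (u m)\<^sup>2 * y ^ (2 ^ (Suc c + m))) = (\<Sum>m<d. u m * y ^ (2 ^ (c + m)))\<^sup>2"
      by (simp add: freshman2_sum char power_mult_distrib mult.commute flip: power_mult)
    then show ?thesis
      using u(2) by simp
  qed
  have period: "y ^ (2 ^ (n + c)) = y ^ (2 ^ c)" for c
    using power_CARD[of y] by (simp only: card power_add power_mult)
  \<comment> \<open>Squaring raises the shift by one and so misses shift 0; starting from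
    \<open>n - 1 + c\<close> and using the period \<open>n\<close> recovers it.\<close>
  have sq0: "(\<Sum>m<d. (u m)\<^sup>2 * y ^ (2 ^ (c + m))) = 0" for c
  proof -
    have "Suc (n - 1 + c) + m = n + (c + m)" for m
      using \<open>1 \<le> n\<close> by simp
    then show ?thesis
      using sq[of "n - 1 + c"] by (simp only: period)
  qed
  \<comment> \<open>Both relations have top coefficient 1, so their difference is shorter and is
    trivial by minimality of \<open>d\<close>.\<close>
  have "(\<Sum>m<d'. ((u m)\<^sup>2 - u m) * y ^ (2 ^ (c + m))) = 0" for c
  proof -
    have "(\<Sum>m<d'. (u m)\<^sup>2 * y ^ (2 ^ (c + m))) + y ^ (2 ^ (c + d')) = 0"
      "(\<Sum>m<d'. u m * y ^ (2 ^ (c + m))) + y ^ (2 ^ (c + d')) = 0"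
      using sq0[of c] u(2)[of c] by (simp_all add: d' u(1))
    then have "(\<Sum>m<d'. (u m)\<^sup>2 * y ^ (2 ^ (c + m))) = (\<Sum>m<d'. u m * y ^ (2 ^ (c + m)))"
      by (simp only: flip: eq_neg_iff_add_eq_0)
    then show ?thesis
      by (simp add: sum_subtractf left_diff_distrib)
  qed
  moreover have "\<not> B d' (\<lambda>m. (u m)\<^sup>2 - u m)"
    using min[of d'] d' by auto
  ultimately have "(u m)\<^sup>2 = u m" if "m < d'" for m
    using that by (auto simp: B_def)
  then have bits: "u m = 0 \<or> u m = 1" if "m < d" for m
    using that u(1) d' by (auto simp: less_Suc_eq power2_eq_square)
  \<comment> \<open>With coefficients in \<open>F_2\<close>, the relation at \<open>c = 0\<close> is
    a nonzero polynomial killing \<open>y\<close>, of degree too small to be a multiple of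
    \<open>p\<close>.\<close>
  obtain r where r: "\<And>m. coeff r m = (if m < d \<and> u m = 1 then 1 else 0)"
    "lin_eval r y = (\<Sum>m<d. u m * y ^ (2 ^ m))"
    using lin_eval_sum_powers[of d u y] bits by metis
  have "p dvd r"
    using ann r(2) u(2)[of 0] by (simp add: annihilator_def)
  moreover have "r \<noteq> 0"
    using r(1)[of d'] u(1) d' by auto
  moreover have "degree r < k"
  proof -
    have "degree r \<le> d'"
      by (rule degree_le) (auto simp: r d')
    then show ?thesis
      using min[OF \<open>B k v\<close>] d' by simp
  qed
  ultimately show False
    using \<open>degree p = k\<close> by (auto dest: dvd_imp_degree_le)
qed

section \<open>Rationality of the coefficients of a monic relation\<close>

text \<open>The defects \<open>e m\<close> satisfy all the relations of length \<open>k\<close>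
  except the one at \<open>c = 0\<close>. Repairing that one yields a relation \<open>g\<close>,
  necessarily a multiple of \<open>w\<close>; comparing coefficients gives a recursion that forces
  \<open>e\<close> to vanish.\<close>

lemma moore_relation_coeffs_idempotent:
  fixes x :: "'a::{field,finite}"
  assumes char: "CHAR('a) = 2"
    and sqrt: "\<And>z::'a. \<exists>y. y\<^sup>2 = z"
    and "2 \<le> k"
    and nondeg: "\<And>v m. (\<And>c. c < k \<Longrightarrow> (\<Sum>m<k. v m * x ^ (2 ^ (c + m))) = 0) \<Longrightarrow> m < k \<Longrightarrow> v m = 0"
    and w: "w k = 1" "w 1 = 0" "\<And>c. c < k \<Longrightarrow> (\<Sum>m\<le>k. w m * x ^ (2 ^ (c + m))) = 0"
    and "m \<le> k"
  shows "(w m)\<^sup>2 = w m"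
proof -
  define Y where "Y m = x ^ (2 ^ m)" for m
  have Y2: "(Y m)\<^sup>2 = Y (Suc m)" for m
    by (simp add: Y_def mult.commute flip: power_mult)
  have N: "v m = 0" if "\<And>c. c < k \<Longrightarrow> (\<Sum>m<k. v m * Y (c + m)) = 0" "m < k" for v m
    using nondeg[of v m] that by (simp add: Y_def)
  have wY: "(\<Sum>m\<le>k. w m * Y (c + m)) = 0" if "c < k" for c
    using w(3)[OF that] by (simp add: Y_def)
  \<comment> \<open>If \<open>w 0 = 0\<close>, the whole relation is a square; its root is a
    relation of length \<open>k\<close> with nonzero top coefficient, against nondegeneracy.\<close>
  have w0: "w 0 \<noteq> 0"
  proof
    assume "w 0 = 0"
    obtain s where s: "\<And>z::'a. (s z)\<^sup>2 = z"
      using sqrt by metis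
    have "(\<Sum>m<k. s (w (Suc m)) * Y (c + m)) = 0" if "c < k" for c
    proof -
      have "(\<Sum>m<k. s (w (Suc m)) * Y (c + m))\<^sup>2 = (\<Sum>m<k. w (Suc m) * Y (c + Suc m))"
        by (simp add: freshman2_sum char power_mult_distrib s Y2)
      also have "\<dots> = (\<Sum>m\<le>k. w m * Y (c + m))"
        using \<open>w 0 = 0\<close> by (simp add: sum.atMost_shift)
      finally show ?thesis
        using wY[OF that] by simp
    qed
    then have "s (w (Suc (k - 1))) = 0"
      by (rule N) (use \<open>2 \<le> k\<close> in auto)
    then have "w k = 0"
      using s[of "w k"] \<open>2 \<le> k\<close> by simp
    then show False
      using w(1) by simp
  qed
  define e where "e m = (w m)\<^sup>2 - w m" for m
  have ek: "e k = 0" and e1: "e 1 = 0"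
    unfolding e_def w by simp_all
  have eY: "(\<Sum>m<k. e m * Y (c + m)) = 0" if "0 < c" "c < k" for c
  proof -
    obtain b where b: "c = Suc b"
      using \<open>0 < c\<close> by (cases c) auto
    have "(\<Sum>m\<le>k. (w m)\<^sup>2 * Y (c + m)) = (\<Sum>m\<le>k. w m * Y (b + m))\<^sup>2"
      by (simp add: freshman2_sum char power_mult_distrib Y2 b)
    also have "\<dots> = 0"
      using wY[of b] that b by simp
    finally have "(\<Sum>m\<le>k. e m * Y (c + m)) = 0"
      using wY[OF \<open>c < k\<close>] by (simp add: e_def left_diff_distrib sum_subtractf)
    then show ?thesis
      by (simp add: ek flip: lessThan_Suc_atMost)
  qed
  define l where "l = (\<Sum>m<k. e m * Y m)"
  \<comment> \<open>With \<open>L z = (\<Sum>m<k. e m * z ^ 2 ^ m)\<close>, which vanishes at \<open>Y c\<close> for \<open>0 < c < k\<close>, \<open>g\<close> is the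
    coefficient sequence of \<open>L\<^sup>2 - L x * L\<close>, which vanishes at \<open>Y 0 = x\<close> as well.\<close>
  define g where "g m = (if m = 0 then 0 else (e (m - 1))\<^sup>2) - l * e m" for m
  have gY: "(\<Sum>m\<le>k. g m * Y (c + m)) = 0" if "c < k" for c
  proof -
    have "(\<Sum>m\<le>k. (if m = 0 then 0 else (e (m - 1))\<^sup>2) * Y (c + m)) = (\<Sum>m<k. e m * Y (c + m))\<^sup>2"
      by (simp add: sum.atMost_shift freshman2_sum char power_mult_distrib Y2)
    moreover have "(\<Sum>m\<le>k. l * e m * Y (c + m)) = l * (\<Sum>m<k. e m * Y (c + m))"
      by (simp add: ek sum_distrib_left mult.assoc flip: lessThan_Suc_atMost)
    ultimately have "(\<Sum>m\<le>k. g m * Y (c + m)) =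
        (\<Sum>m<k. e m * Y (c + m))\<^sup>2 - l * (\<Sum>m<k. e m * Y (c + m))"
      by (simp add: g_def left_diff_distrib sum_subtractf)
    also have "\<dots> = 0"
      using eY[of c] that by (cases "c = 0") (auto simp: l_def power2_eq_square)
    finally show ?thesis .
  qed
  \<comment> \<open>Subtracting \<open>g k * w\<close> removes the top term, and nondegeneracy kills
    the remaining relation of length \<open>k\<close>.\<close>
  have g: "g m = g k * w m" if "m \<le> k" for m
  proof (cases "m = k")
    case False
    have "(\<Sum>m<k. (g m - g k * w m) * Y (c + m)) = 0" if "c < k" for c
    proof -
      have "(\<Sum>m<k. (g m - g k * w m) * Y (c + m)) = (\<Sum>m\<le>k. (g m - g k * w m) * Y (c + m))"
        by (simp add: w flip: lessThan_Suc_atMost)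
      also have "\<dots> = (\<Sum>m\<le>k. g m * Y (c + m)) - g k * (\<Sum>m\<le>k. w m * Y (c + m))"
        by (simp add: left_diff_distrib sum_subtractf sum_distrib_left mult.assoc)
      finally show ?thesis
        using gY wY that by simp
    qed
    then have "g m - g k * w m = 0"
      by (rule N) (use that False in auto)
    then show ?thesis
      by simp
  qed (simp add: w)
  \<comment> \<open>At index 1, \<open>w 1 = e 1 = 0\<close> leaves
    \<open>(e 0)\<^sup>2 = 0\<close>. Index 0 then gives \<open>g k * w 0 = 0\<close>, so
    \<open>g\<close> vanishes up to \<open>k\<close>.\<close>
  have e0: "e 0 = 0"
    using g[of 1] \<open>2 \<le> k\<close> by (simp add: w[unfolded One_nat_def] g_def e1[unfolded One_nat_def])
  have "g k = 0"
    using g[of 0] w0 by (simp add: g_def e0)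
  then have rec: "(e m)\<^sup>2 = l * e (Suc m)" if "m < k" for m
    using g[of "Suc m"] that by (simp add: g_def)
  \<comment> \<open>If \<open>l = 0\<close> the recursion makes each square zero; otherwise it
    propagates \<open>e 0 = 0\<close> upwards.\<close>
  have "e m = 0" if "m \<le> k" for m
  proof (cases "l = 0")
    case True
    then show ?thesis
      using rec[of m] that ek by (cases "m = k") auto
  next
    case False
    show ?thesis
      using that
    proof (induction m)
      case (Suc m)
      then show ?case
        using rec[of m] False by simp
    qed (rule e0)
  qed
  then show ?thesis
    using \<open>m \<le> k\<close> by (simp add: e_def)
qed

section \<open>The equivalence\<close>

theorem theorem3p1:
  fixes n k :: nat
  assumes "n \<ge> 1" and "1 \<le> k" and "k \<le> n"
    and "CARD('a::{field,finite}) = 2 ^ n"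
  shows "(\<exists>x::'a. moore_det k (\<lambda>i. x ^ (2 ^ i)) \<noteq> 0 \<and> moore_det1 k (\<lambda>i. x ^ (2 ^ i)) = 0)
    \<longleftrightarrow> (\<exists>p::bit poly. degree p = k \<and> lead_coeff p = 1 \<and> coeff p 1 = 0 \<and> p dvd monom 1 n - 1)"
proof
  note char = CHAR_of_card_two_power[OF assms(4)]
  let ?P = "monom 1 n - 1 :: bit poly"
  assume "\<exists>x::'a. moore_det k (\<lambda>i. x ^ (2 ^ i)) \<noteq> 0 \<and> moore_det1 k (\<lambda>i. x ^ (2 ^ i)) = 0"
  then obtain x :: 'a where x: "moore_det k (\<lambda>i. x ^ (2 ^ i)) \<noteq> 0" "moore_det1 k (\<lambda>i. x ^ (2 ^ i)) = 0"
    by blast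
  have nondeg: "v m = 0" if "\<And>c. c < k \<Longrightarrow> (\<Sum>m<k. v m * x ^ (2 ^ (c + m))) = 0" "m < k" for v m
  proof -
    have "(\<Sum>m<k. (if m < k then v m else 0) * x ^ (2 ^ (c + m))) = 0" if "c < k" for c
      using \<open>\<And>c. c < k \<Longrightarrow> (\<Sum>m<k. v m * x ^ (2 ^ (c + m))) = 0\<close>[OF that] by simp
    then show ?thesis
      using x(1) \<open>m < k\<close> unfolding moore_det_powers_eq_0_iff
      by (auto dest!: spec[of _ "\<lambda>m. if m < k then v m else 0"])
  qed
  obtain w0 where w0: "w0 1 = 0" "\<exists>m\<le>k. w0 m \<noteq> 0" "\<And>c. c < k \<Longrightarrow> (\<Sum>m\<le>k. w0 m * x ^ (2 ^ (c + m))) = 0"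
    using x(2) moore_det1_powers_eq_0_iff[OF assms(2), of x] by blast
  have "w0 k \<noteq> 0"
  proof
    assume "w0 k = 0"
    then have "(\<Sum>m<k. w0 m * x ^ (2 ^ (c + m))) = 0" if "c < k" for c
      using w0(3)[OF that] by (simp flip: lessThan_Suc_atMost)
    then have "w0 m = 0" if "m < k" for m
      using nondeg that by blast
    then show False
      using w0(2) \<open>w0 k = 0\<close> by (auto simp: le_less)
  qed
  define w where "w m = w0 m / w0 k" for m
  have w: "w k = 1" "w 1 = 0"
    using \<open>w0 k \<noteq> 0\<close> w0(1) by (simp_all add: w_def)
  have wY: "(\<Sum>m\<le>k. w m * x ^ (2 ^ (c + m))) = 0" if "c < k" for c
  proof -
    have "(\<Sum>m\<le>k. w m * x ^ (2 ^ (c + m))) = (\<Sum>m\<le>k. w0 m * x ^ (2 ^ (c + m))) / w0 k"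
      by (simp add: w_def sum_divide_distrib)
    then show ?thesis
      using w0(3)[OF that] by simp
  qed
  \<comment> \<open>For \<open>k = 1\<close> the leading coefficient would be the one required to
    vanish.\<close>
  have "k \<noteq> 1"
    using w by auto
  \<comment> \<open>The root is \<open>z ^ 2 ^ (n - 1)\<close>, because
    \<open>z ^ 2 ^ n = z\<close>.\<close>
  have sqrt: "\<exists>y. y\<^sup>2 = z" for z :: 'a
    using power_CARD[of z] assms(1,4) power_mult[of z "2 ^ (n - 1)" 2]
    by (metis One_nat_def Suc_diff_le Suc_pred diff_Suc_1 less_eq_Suc_le mult.commute power_Suc)
  have idem: "(w m)\<^sup>2 = w m" if "m \<le> k" for m
    by (rule moore_relation_coeffs_idempotent[where x = x and k = k])
       (use char sqrt \<open>k \<noteq> 1\<close> assms(2) nondeg w wY that in auto)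
  obtain p where p: "\<And>m. coeff p m = (if m < Suc k \<and> w m = 1 then 1 else 0)"
    "lin_eval p x = (\<Sum>m<Suc k. w m * x ^ (2 ^ m))"
    using lin_eval_sum_powers[of "Suc k" w x] idem by (auto simp: less_Suc_eq_le power2_eq_square)
  have deg: "degree p = k"
    by (intro antisym degree_le le_degree) (auto simp: p w)
  have p0: "p \<noteq> 0"
    using p(1)[of k] w by auto
  have "lin_eval p x = 0"
    using p(2) wY[of 0] assms(2) by (simp add: lessThan_Suc_atMost)
  moreover have "lin_eval ?P x = 0"
    using power_CARD[of x] by (simp add: lin_eval_diff lin_eval_monom char assms(4))
  ultimately have r0: "lin_eval (?P mod p) x = 0"
    using lin_eval_diff[OF char, of ?P "?P div p * p" x]
    by (simp add: minus_div_mult_eq_mod lin_eval_mult char)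
  \<comment> \<open>The remainder kills \<open>x\<close> and all its conjugates, so its coefficients
    form a relation of length \<open>k\<close>, trivial by \<open>nondeg\<close>.\<close>
  have "r = 0" if r: "r = ?P mod p" for r
  proof (rule ccontr)
    assume nz: "r \<noteq> 0"
    then have lt: "degree r < k"
      using degree_mod_less[OF p0, of ?P] deg r by auto
    have "(\<Sum>m<k. bit_emb (coeff r m) * x ^ (2 ^ (c + m))) = lin_eval r x ^ (2 ^ c)" for c
      unfolding lin_eval_frobenius[OF char, symmetric] unfolding lin_eval_lessThan[OF lt]
      by (simp only: power_two_power_power)
    moreover have "lin_eval r x = 0"
      using r0 by (simp only: r)
    ultimately have "bit_emb (lead_coeff r) = (0 :: 'a)"
      by (intro nondeg[OF _ lt, of "\<lambda>m. bit_emb (coeff r m)"]) simp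
    then show False
      using nz by (simp only: bit_emb_eq_0_iff leading_coeff_0_iff)
  qed
  then have "p dvd ?P"
    by auto
  then show "\<exists>p::bit poly. degree p = k \<and> lead_coeff p = 1 \<and> coeff p 1 = 0 \<and> p dvd ?P"
    using deg p(1) w by (intro exI[of _ p]) auto
next
  note char = CHAR_of_card_two_power[OF assms(4)]
  let ?P = "monom 1 n - 1 :: bit poly"
  assume "\<exists>p::bit poly. degree p = k \<and> lead_coeff p = 1 \<and> coeff p 1 = 0 \<and> p dvd ?P"
  then obtain p q :: "bit poly" where p: "degree p = k" "lead_coeff p = 1" "coeff p 1 = 0" "?P = q * p"
    by (metis dvdE mult.commute)
  obtain z :: 'a where "annihilator z ?P"
    using normal_element_exists[OF assms(1,4)] .
  \<comment> \<open>The witness is \<open>q(\<sigma>) z\<close>, whose annihilator is the cofactor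
    \<open>p\<close>.\<close>
  then obtain y :: 'a where y: "annihilator y p"
    using annihilator_lin_eval[OF char] p(4) by metis
  have "moore_det k (\<lambda>i. y ^ (2 ^ i)) \<noteq> 0"
    using moore_det_nonzero_of_annihilator[OF assms(1,4) y p(1)] .
  moreover have "moore_det1 k (\<lambda>i. y ^ (2 ^ i)) = 0"
    unfolding moore_det1_powers_eq_0_iff[OF assms(2)]
  \<comment> \<open>The coefficients of \<open>p\<close> themselves are the relation: applying
    \<sigma> repeatedly to \<open>p(\<sigma>) y = 0\<close> gives every shift
    \<open>c\<close>.\<close>
  proof (intro exI[of _ "\<lambda>m. bit_emb (coeff p m)"] conjI allI impI)
    show "bit_emb (coeff p 1) = (0 :: 'a)"
      by (simp only: p bit_emb_simps)
    show "\<exists>m\<le>k. bit_emb (coeff p m) \<noteq> (0 :: 'a)"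
      using p by (intro exI[of _ k]) simp
    have "lin_eval p y ^ (2 ^ c) = (\<Sum>m\<le>k. bit_emb (coeff p m) * y ^ (2 ^ (c + m)))" for c
      unfolding lin_eval_frobenius[OF char, symmetric] unfolding lin_eval_def[of p] p(1)
      by (simp only: power_two_power_power)
    moreover have "lin_eval p y = 0"
      using y by (simp add: annihilator_def)
    ultimately show "(\<Sum>m\<le>k. bit_emb (coeff p m) * y ^ (2 ^ (c + m))) = 0" for c
      by (metis power_eq_0_iff zero_less_numeral zero_less_power)
  qed
  ultimately show "\<exists>x::'a. moore_det k (\<lambda>i. x ^ (2 ^ i)) \<noteq> 0 \<and> moore_det1 k (\<lambda>i. x ^ (2 ^ i)) = 0"
    by blast
qed

end
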